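(* Let $k\ge 1$ be an integer and let $F$ and $F'$ be graphs. Let $G=F\circ\overline{K_k}$ and $H=F'\circ\overline{K_k}$ be the $k$-coronas of $F$ and $F'$. Then $$\gamma_k^{\mathrm L}(G\square H)=\frac{n(G)\,n(H)}{k+1}.$$
   Context: All graphs are finite and simple; $n(G)=|V(G)|$, and $N_G(u)$ is the open neighborhood of $u$ in $G$. A set $D\subseteq V(G)$ is a dominating set if every vertex of $V(G)\setminus D$ has a neighbor in $D$. For an integer $k\ge 0$, a dominating set $D$ of $G$ is a $k$-limited dominating set if $|N_G(u)\setminus D|\le k$ for every $u\in D$. The $k$-limited domination number $\gamma_k^{\mathrm L}(G)$ is the minimum cardinality of a $k$-limited dominating set of $G$. The Cartesian product $G\square H$ has vertex set $V(G)\times V(H)$, with $(g,h)$ and $(g',h')$ adjacent if and only if either $g=g'$ and $hh'\in E(H)$, or $h=h'$ and $gg'\in E(G)$. The $k$-corona $F\circ\overline{K_k}$ of a graph $F$ is the graph obtained from $F$ by attaching $k$ new leaves to each vertex of $F$ (so it has $(k+1)\,n(F)$ vertices). *)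

theory Defs
  imports Complex_Main "Graph_Theory.Pair_Digraph"
begin

text \<open>
  A finite simple graph is a \<open>pair_graph\<close>: finite, loopless and symmetric, with each undirected
  edge stored as two opposite arcs and no requirement that the vertex set be nonempty.
\<close>

definition neighborhood :: "'a pair_pre_digraph \<Rightarrow> 'a \<Rightarrow> 'a set" where
  "neighborhood G u = {v. (u, v) \<in> parcs G}"

definition dominating_set :: "'a pair_pre_digraph \<Rightarrow> 'a set \<Rightarrow> bool" where
  "dominating_set G D \<longleftrightarrow>
     D \<subseteq> pverts G \<and> (\<forall>v \<in> pverts G - D. \<exists>u \<in> D. u \<in> neighborhood G v)"

definition limited_dominating_set :: "nat \<Rightarrow> 'a pair_pre_digraph \<Rightarrow> 'a set \<Rightarrow> bool" where
  "limited_dominating_set k G D \<longleftrightarrow>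
     dominating_set G D \<and> (\<forall>u \<in> D. card (neighborhood G u - D) \<le> k)"

definition limited_domination_number :: "nat \<Rightarrow> 'a pair_pre_digraph \<Rightarrow> nat" where
  "limited_domination_number k G = Min (card ` {D. limited_dominating_set k G D})"

definition cartesian_product ::
    "'a pair_pre_digraph \<Rightarrow> 'b pair_pre_digraph \<Rightarrow> ('a \<times> 'b) pair_pre_digraph"  (infixl "\<box>" 70) where
  "G \<box> H = \<lparr>
     pverts = pverts G \<times> pverts H,
     parcs = {((g, h), (g', h')) | g h g' h'.
                g \<in> pverts G \<and> g' \<in> pverts G \<and> h \<in> pverts H \<and> h' \<in> pverts H \<and>
                (g = g' \<and> (h, h') \<in> parcs H \<or> h = h' \<and> (g, g') \<in> parcs G)} \<rparr>"

text \<open>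
  In the \<open>k\<close>-corona, \<open>Inl v\<close> is the original vertex \<open>v\<close>, and \<open>Inr (v, i)\<close> with \<open>i < k\<close> is the
  \<open>i\<close>-th leaf attached to \<open>v\<close>.
\<close>

definition corona :: "'a pair_pre_digraph \<Rightarrow> nat \<Rightarrow> ('a + 'a \<times> nat) pair_pre_digraph" where
  "corona F k = \<lparr>
     pverts = Inl ` pverts F \<union> Inr ` (pverts F \<times> {..<k}),
     parcs = {(Inl u, Inl v) | u v. (u, v) \<in> parcs F}
           \<union> {(Inl v, Inr (v, i)) | v i. v \<in> pverts F \<and> i < k}
           \<union> {(Inr (v, i), Inl v) | v i. v \<in> pverts F \<and> i < k} \<rparr>"

lemma pair_graphI:
  assumes "finite (pverts G)"
    and "\<And>u v. (u, v) \<in> parcs G \<Longrightarrow> u \<in> pverts G \<and> v \<in> pverts G \<and> u \<noteq> v \<and> (v, u) \<in> parcs G"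
  shows "pair_graph G"
proof -
  have "parcs G \<subseteq> pverts G \<times> pverts G" using assms(2) by auto
  then have "finite (parcs G)" using assms(1) finite_subset by blast
  then show ?thesis
    using assms by unfold_locales (auto simp: symmetric_def intro!: symI)
qed

lemma pair_graphD:
  assumes "pair_graph G"
  shows "finite (pverts G)"
    and "(u, v) \<in> parcs G \<Longrightarrow> u \<in> pverts G \<and> v \<in> pverts G \<and> u \<noteq> v \<and> (v, u) \<in> parcs G"
proof -
  interpret pair_graph G by fact
  show "finite (pverts G)" by (rule pair_finite_verts)
  show "(u, v) \<in> parcs G \<Longrightarrow> u \<in> pverts G \<and> v \<in> pverts G \<and> u \<noteq> v \<and> (v, u) \<in> parcs G"
    using in_arcsD1 in_arcsD2 no_loops' pair_sym_arcs
    by (auto simp: symmetric_def dest: symD)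
qed

lemma pair_graph_cartesian_product:
  assumes "pair_graph G" "pair_graph H"
  shows "pair_graph (G \<box> H)"
  by (rule pair_graphI)
     (auto simp: cartesian_product_def dest: pair_graphD(2)[OF assms(1)] pair_graphD(2)[OF assms(2)]
           intro: pair_graphD(1)[OF assms(1)] pair_graphD(1)[OF assms(2)])

lemma pair_graph_corona:
  assumes "pair_graph F"
  shows "pair_graph (corona F k)"
  by (rule pair_graphI)
     (auto simp: corona_def dest: pair_graphD(2)[OF assms] intro: pair_graphD(1)[OF assms])

lemma card_pverts_corona:
  assumes "pair_graph F"
  shows "card (pverts (corona F k)) = (k + 1) * card (pverts F)"
proof -
  have "finite (pverts F)" using assms by (rule pair_graphD(1))
  then have "card (pverts (corona F k))
      = card (Inl ` pverts F :: ('a + 'a \<times> nat) set)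
        + card (Inr ` (pverts F \<times> {..<k}) :: ('a + 'a \<times> nat) set)"
    by (auto simp: corona_def intro!: card_Un_disjoint)
  then show ?thesis
    by (simp add: card_image card_cartesian_product)
qed

lemma limited_domination_number_attained:
  assumes "pair_graph G"
  obtains D where "limited_dominating_set k G D" "card D = limited_domination_number k G"
proof -
  let ?S = "{D. limited_dominating_set k G D}"
  note fin = pair_graphD(1)[OF assms]
  have "?S \<subseteq> Pow (pverts G)"
    by (auto simp: limited_dominating_set_def dominating_set_def)
  then have "finite (card ` ?S)" using fin finite_subset by blast
  moreover have "neighborhood G u - pverts G = {}" for u
    using pair_graphD(2)[OF assms] by (auto simp: neighborhood_def)
  then have "card (neighborhood G u - pverts G) \<le> k" for u
    by (metis card.empty le0)
  then have "pverts G \<in> ?S"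
    by (auto simp: limited_dominating_set_def dominating_set_def)
  ultimately have "Min (card ` ?S) \<in> card ` ?S"
    by (intro Min_in) auto
  then show ?thesis
    using that by (auto simp: limited_domination_number_def)
qed

end

theory Submission
  imports Defs
begin

text \<open>
  A vertex of a \<open>k\<close>-limited dominating set covers itself and at most \<open>k\<close> further vertices, which
  gives the lower bound in every graph. In a corona the original vertices cover exactly \<open>k\<close> leaves
  each, and this perfect covering lifts to the fibres of the product.
\<close>

text \<open>This is a union bound: the sets \<open>neighborhood G u - D\<close> for \<open>u\<close>
  in \<open>D\<close> cover everything outside \<open>D\<close>, and each has at most
  \<open>k\<close> elements.\<close>

lemma card_pverts_le_limited_dominating_set:
  assumes "pair_graph G" and D: "limited_dominating_set k G D"
  shows "card (pverts G) \<le> (k + 1) * card D"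
proof -
  note arcs = pair_graphD(2)[OF \<open>pair_graph G\<close>]
  note fin = pair_graphD(1)[OF \<open>pair_graph G\<close>]
  have sub: "D \<subseteq> pverts G" and dom: "\<forall>v \<in> pverts G - D. \<exists>u \<in> D. u \<in> neighborhood G v"
    and lim: "\<And>u. u \<in> D \<Longrightarrow> card (neighborhood G u - D) \<le> k"
    using D by (auto simp: limited_dominating_set_def dominating_set_def)
  have finD: "finite D" using sub fin by (rule finite_subset)
  have finN: "finite (neighborhood G u)" for u
    by (rule finite_subset[OF _ fin]) (auto simp: neighborhood_def dest: arcs)
  \<comment> \<open>Domination puts \<open>u\<close> in the neighborhood of \<open>v\<close>;
    symmetry of the arcs turns this around, so that \<open>v\<close> is counted at its dominator
    \<open>u\<close>.\<close>
  have "pverts G \<subseteq> D \<union> (\<Union>u\<in>D. neighborhood G u - D)"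
    using dom by (fastforce simp: neighborhood_def dest: arcs)
  then have "card (pverts G) \<le> card (D \<union> (\<Union>u\<in>D. neighborhood G u - D))"
    using finD finN by (intro card_mono) auto
  also have "\<dots> \<le> card D + card (\<Union>u\<in>D. neighborhood G u - D)"
    by (rule card_Un_le)
  also have "\<dots> \<le> card D + (\<Sum>u\<in>D. card (neighborhood G u - D))"
    by (intro add_left_mono card_UN_le finD)
  also have "\<dots> \<le> card D + card D * k"
    using sum_bounded_above[of D "\<lambda>u. card (neighborhood G u - D)" k] lim by simp
  finally show ?thesis by (simp add: algebra_simps)
qed

text \<open>A set attaining the counting bound with equality is minimum. Equality is stated as a
  product, which avoids rounding in division on \<open>nat\<close>.\<close>

lemma limited_domination_number_eqI:
  assumes "pair_graph G" and D: "limited_dominating_set k G D"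
    and "(k + 1) * card D = card (pverts G)"
  shows "limited_domination_number k G = card D"
  unfolding limited_domination_number_def
proof (rule Min_eqI)
  \<comment> \<open>\<open>Min\<close> is a true minimum only over a finite set; the candidates are
    subsets of a finite vertex set.\<close>
  have "{D. limited_dominating_set k G D} \<subseteq> Pow (pverts G)"
    by (auto simp: limited_dominating_set_def dominating_set_def)
  then show "finite (card ` {D. limited_dominating_set k G D})"
    using pair_graphD(1)[OF \<open>pair_graph G\<close>] finite_subset by blast
  show "card D \<le> n" if n: "n \<in> card ` {D. limited_dominating_set k G D}" for n
  proof -
    obtain E where E: "limited_dominating_set k G E" "n = card E" using n by blast
    then have "(k + 1) * card D \<le> (k + 1) * n"
      using card_pverts_le_limited_dominating_set[OF \<open>pair_graph G\<close>] assms(3) by metis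
    then show ?thesis by (simp only: mult_le_cancel1)
  qed
  show "card D \<in> card ` {D. limited_dominating_set k G D}" using D by blast
qed

text \<open>A leaf \<open>(Inr (v, i), h)\<close> is dominated by its stem \<open>(Inl v, h)\<close>
  in the same copy of the corona.\<close>

lemma limited_dominating_set_corona_product:
  fixes F :: "'a pair_pre_digraph"
  assumes "pair_graph F" "pair_graph H"
  shows "limited_dominating_set k (corona F k \<box> H) (Inl ` pverts F \<times> pverts H)"
    (is "limited_dominating_set k ?P ?D")
  unfolding limited_dominating_set_def dominating_set_def
proof (intro conjI ballI)
  show "?D \<subseteq> pverts ?P" by (auto simp: cartesian_product_def corona_def)
  show "\<exists>u\<in>?D. u \<in> neighborhood ?P x" if x: "x \<in> pverts ?P - ?D" for x
  proof -
    obtain v i h where "x = (Inr (v, i), h)" "v \<in> pverts F" "i < k" "h \<in> pverts H"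
      using x by (auto simp: cartesian_product_def corona_def)
    then show ?thesis
      by (intro bexI[of _ "(Inl v, h)"])
         (auto simp: neighborhood_def cartesian_product_def corona_def)
  qed
  show "card (neighborhood ?P u - ?D) \<le> k" if u_D: "u \<in> ?D" for u
  proof -
    obtain v h where u: "u = (Inl v, h)" using u_D by blast
    \<comment> \<open>Moves along \<open>H\<close> keep the first coordinate \<open>Inl v\<close>,
      and moves along arcs of \<open>F\<close> reach another original vertex. Both stay in the set,
      so only the \<open>k\<close> leaves at \<open>v\<close> lie outside.\<close>
    have "neighborhood ?P u - ?D \<subseteq> (\<lambda>i. (Inr (v, i), h)) ` {..<k}"
      unfolding u by (auto simp: neighborhood_def cartesian_product_def corona_def)
    then have "card (neighborhood ?P u - ?D) \<le> card {..<k}"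
      by (rule surj_card_le[rotated]) simp
    then show ?thesis by simp
  qed
qed

theorem proposition11:
  fixes k :: nat
    and F :: "'a pair_pre_digraph"
    and F' :: "'b pair_pre_digraph"
    and G :: "('a + 'a \<times> nat) pair_pre_digraph"
    and H :: "('b + 'b \<times> nat) pair_pre_digraph"
  assumes "k \<ge> 1"
    and "pair_graph F"
    and "pair_graph F'"
    and "G = corona F k"
    and "H = corona F' k"
  shows "real (limited_domination_number k (G \<box> H))
           = real (card (pverts G)) * real (card (pverts H)) / (real k + 1)"
proof -
  let ?D = "(Inl ` pverts F :: ('a + 'a \<times> nat) set) \<times> pverts H"
  note H = pair_graph_corona[OF assms(3), of k, folded assms(5)]
  note P = pair_graph_cartesian_product[OF pair_graph_corona[OF assms(2), of k] H]
  have cardG: "card (pverts G) = (k + 1) * card (pverts F)"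
    using card_pverts_corona[OF assms(2)] assms(4) by simp
  have cardD: "card ?D = card (pverts F) * card (pverts H)"
    by (simp add: card_cartesian_product card_image)
  have "card (pverts (G \<box> H)) = card (pverts G) * card (pverts H)"
    by (simp add: cartesian_product_def card_cartesian_product)
  \<comment> \<open>Original vertices form a fraction 1/(k+1) of \<open>G\<close>, and taking the
    product with all of \<open>H\<close> preserves this ratio, so the bound is tight.\<close>
  then have "(k + 1) * card ?D = card (pverts (G \<box> H))"
    by (simp only: cardG cardD mult.assoc)
  then have "limited_domination_number k (G \<box> H) = card ?D"
    unfolding assms(4)
    by (rule limited_domination_number_eqI[OF P limited_dominating_set_corona_product[OF assms(2) H]])
  then show ?thesis
    unfolding cardG cardD by (simp add: field_simps)
qed

end
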